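(* There is a real Banach space of density continuum (that is, the minimal cardinality of a norm-dense subset is $2^{\aleph_0}$) which does not admit an infinite equilateral set.
   Context: All Banach spaces are over the reals. A subset $\mathcal{Y}$ of a Banach space is $r$-equilateral ($r>0$) if $\|x-y\|=r$ for any two distinct $x,y\in\mathcal{Y}$; it is equilateral if it is $r$-equilateral for some real $r>0$. *)

theory Defs
  imports "HOL-Algebra.Module" "HOL-Analysis.Analysis"
begin

definition real_scalars :: "real ring" where
  "real_scalars = \<lparr>carrier = UNIV, monoid.mult = (*), one = 1, zero = 0, add = (+)\<rparr>"

text \<open>
  Real normed spaces with an explicit carrier, so that one can assert the existence of a space
  inside a formula, which is impossible for the type class \<^class>\<open>real_normed_vector\<close>. The
  vector space structure is that of a module over the field of real numbers; the components
  \<^const>\<open>monoid.mult\<close> and \<^const>\<open>monoid.one\<close> of the record \<open>V\<close> play no role. The qualified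
  name distinguishes the algebraic locale from the one in \<^theory>\<open>HOL.Modules\<close>.
\<close>

locale real_normed_space = Module.module real_scalars V
  for V :: "(real, 'v) module" (structure) +
  fixes N :: "'v \<Rightarrow> real"
  assumes N_eq_0_iff: "x \<in> carrier V \<Longrightarrow> N x = 0 \<longleftrightarrow> x = \<zero>"
    and N_triangle: "\<lbrakk>x \<in> carrier V; y \<in> carrier V\<rbrakk> \<Longrightarrow> N (x \<oplus> y) \<le> N x + N y"
    and N_smult: "x \<in> carrier V \<Longrightarrow> N (a \<odot> x) = \<bar>a\<bar> * N x"

text \<open>
  The value outside the carrier is immaterial; it is set to 0 because \<^locale>\<open>Metric_space\<close>
  requires nonnegativity and symmetry on the whole type.
\<close>

definition norm_dist :: "(real, 'v) module \<Rightarrow> ('v \<Rightarrow> real) \<Rightarrow> 'v \<Rightarrow> 'v \<Rightarrow> real" where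
  "norm_dist V N x y =
     (if x \<in> carrier V \<and> y \<in> carrier V then N (x \<ominus>\<^bsub>V\<^esub> y) else 0)"

definition norm_topology :: "(real, 'v) module \<Rightarrow> ('v \<Rightarrow> real) \<Rightarrow> 'v topology" where
  "norm_topology V N = Metric_space.mtopology (carrier V) (norm_dist V N)"

context real_normed_space
begin

lemma N_uminus:
  assumes "x \<in> carrier V"
  shows "N (\<ominus> x) = N x"
proof -
  have c: "(-1::real) \<in> carrier real_scalars" "(1::real) \<in> carrier real_scalars"
    by (simp_all add: real_scalars_def)
  have "(-1) \<odot> x \<oplus> x = (-1) \<odot> x \<oplus> 1 \<odot> x"
    using smult_one[OF assms] by (simp add: real_scalars_def)
  also have "\<dots> = 0 \<odot> x"
    using smult_l_distr[OF c assms] by (simp add: real_scalars_def)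
  also have "\<dots> = \<zero>"
    using smult_l_null[OF assms] by (simp add: real_scalars_def)
  finally have "\<ominus> x = (-1) \<odot> x"
    using M.minus_equality assms c(1) smult_closed by blast
  then show ?thesis
    using N_smult[OF assms, of "-1"] by simp
qed

lemma N_nonneg:
  assumes "x \<in> carrier V"
  shows "0 \<le> N x"
proof -
  have "N (x \<oplus> \<ominus> x) \<le> N x + N (\<ominus> x)"
    using assms by (intro N_triangle) auto
  moreover have "N (x \<oplus> \<ominus> x) = 0"
    using assms N_eq_0_iff by (simp add: M.r_neg)
  ultimately show ?thesis
    using N_uminus[OF assms] by simp
qed

sublocale Metric_space "carrier V" "norm_dist V N"
proof
  show "0 \<le> norm_dist V N x y" for x y
    by (simp add: norm_dist_def N_nonneg)
  show "norm_dist V N x y = norm_dist V N y x" for x y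
  proof (cases "x \<in> carrier V \<and> y \<in> carrier V")
    case True
    then have "y \<ominus> x = \<ominus> (x \<ominus> y)"
      by (simp add: a_minus_def M.minus_add M.a_comm)
    with True show ?thesis
      by (simp add: norm_dist_def N_uminus)
  qed (auto simp: norm_dist_def)
  show "norm_dist V N x y = 0 \<longleftrightarrow> x = y" if "x \<in> carrier V" "y \<in> carrier V" for x y
  proof -
    have "x \<ominus> y = \<zero> \<longleftrightarrow> x = y"
      using that M.minus_equality[of x "\<ominus> y"] by (auto simp: a_minus_def M.r_neg)
    with that show ?thesis
      by (simp add: norm_dist_def N_eq_0_iff)
  qed
  show "norm_dist V N x z \<le> norm_dist V N x y + norm_dist V N y z"
    if "x \<in> carrier V" "y \<in> carrier V" "z \<in> carrier V" for x y z
  proof -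
    have "(x \<ominus> y) \<oplus> (y \<ominus> z) = x \<oplus> ((\<ominus> y \<oplus> y) \<oplus> \<ominus> z)"
      using that by (simp add: a_minus_def M.a_assoc)
    also have "\<dots> = x \<ominus> z"
      using that by (simp add: a_minus_def M.l_neg)
    finally show ?thesis
      using that N_triangle[of "x \<ominus> y" "y \<ominus> z"] by (simp add: norm_dist_def)
  qed
qed

end

locale real_banach_space = real_normed_space +
  assumes complete: mcomplete

definition equilateral :: "(real, 'v) module \<Rightarrow> ('v \<Rightarrow> real) \<Rightarrow> real \<Rightarrow> 'v set \<Rightarrow> bool" where
  "equilateral V N r Y \<longleftrightarrow>
     0 < r \<and> Y \<subseteq> carrier V \<and> (\<forall>x\<in>Y. \<forall>y\<in>Y. x \<noteq> y \<longrightarrow> N (x \<ominus>\<^bsub>V\<^esub> y) = r)"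

definition dense_in :: "'a topology \<Rightarrow> 'a set \<Rightarrow> bool" where
  "dense_in X D \<longleftrightarrow> D \<subseteq> topspace X \<and> X closure_of D = topspace X"

text \<open>The least cardinality of a dense subset of \<open>X\<close> is the cardinality of \<open>K\<close>.\<close>

definition has_density :: "'a topology \<Rightarrow> 'b set \<Rightarrow> bool" where
  "has_density X K \<longleftrightarrow>
     (\<exists>D. dense_in X D \<and> D \<approx> K) \<and> (\<forall>D. dense_in X D \<longrightarrow> K \<lesssim> D)"

end

(* Renorm l1(R) by N x = |x|_1 + |T x|, where T maps l1(R) injectively and boundedly into a pre-Hilbert
   space and sends bounded sequences to precompact ones. Given a bounded r-equilateral sequence (x_n),
   choose a filter along which it converges pointwise to some x and T x_n converges in norm to some w
   (w need not be T x). Put z_n = x_n - x and u_n = T x_n - w. As z_m tends to 0 pointwise,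
   |z_n - z_m|_1 is asymptotically |z_n|_1 + |z_m|_1; writing a for the limit of |z_m|_1, this
   gives |z_n|_1 + |u_n| = r - a for every n, and the limit over n gives r = 2 a. Hence the triangle
   inequality |u_n - u_m| <= |u_n| + |u_m| is an equality for all n, m distinct. By strict
   convexity at most two u_n are nonzero, so T x_n = w for all other n, against the injectivity of T. *)
theory Submission
  imports Defs
begin

section \<open>Weighted square-summable sequences\<close>

text \<open>
  The weights \<open>1/2 ^ k\<close> make every bounded sequence square-summable, and on bounded sets the norm
  topology is that of pointwise convergence.
\<close>

typedef wl2 = "{a :: nat \<Rightarrow> real. bounded (range a)}"
  morphisms coord Abs_wl2
  by (rule exI[of _ "\<lambda>_. 0"]) auto

setup_lifting type_definition_wl2

lemma summable_weighted_product:
  fixes a b :: "nat \<Rightarrow> real"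
  assumes "bounded (range a)" "bounded (range b)"
  shows "summable (\<lambda>k. (1/2) ^ k * (a k * b k))"
proof -
  obtain A B where A: "\<And>k. \<bar>a k\<bar> \<le> A" and B: "\<And>k. \<bar>b k\<bar> \<le> B"
    using assms unfolding bounded_iff by auto
  show ?thesis
  proof (rule summable_comparison_test')
    show "summable (\<lambda>k. (1/2) ^ k * (A * B) :: real)"
      by (intro summable_mult2 summable_geometric) simp
    show "norm ((1/2) ^ k * (a k * b k)) \<le> (1/2) ^ k * (A * B)" for k
      unfolding norm_mult using A[of k] B[of k]
      by (intro mult_mono) auto
  qed
qed

lemma bounded_coord [simp]: "bounded (range (coord a))"
  using coord[of a] by simp

lemma summable_inner_wl2: "summable (\<lambda>k. (1/2) ^ k * (coord a k * coord b k))"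
  by (rule summable_weighted_product) simp_all

instantiation wl2 :: real_inner
begin

lift_definition zero_wl2 :: wl2 is "\<lambda>_. 0" by auto
lift_definition plus_wl2 :: "wl2 \<Rightarrow> wl2 \<Rightarrow> wl2" is "\<lambda>a b k. a k + b k"
  by (rule bounded_plus_comp)
lift_definition minus_wl2 :: "wl2 \<Rightarrow> wl2 \<Rightarrow> wl2" is "\<lambda>a b k. a k - b k"
  by (rule bounded_minus_comp)
lift_definition uminus_wl2 :: "wl2 \<Rightarrow> wl2" is "\<lambda>a k. - a k"
  by (simp add: bounded_iff)
lift_definition scaleR_wl2 :: "real \<Rightarrow> wl2 \<Rightarrow> wl2" is "\<lambda>c a k. c * a k"
  by (simp only: real_scaleR_def[symmetric] bounded_scaleR_comp)
lift_definition inner_wl2 :: "wl2 \<Rightarrow> wl2 \<Rightarrow> real" is "\<lambda>a b. \<Sum>k. (1/2) ^ k * (a k * b k)" .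

definition norm_wl2 :: "wl2 \<Rightarrow> real" where "norm_wl2 a = sqrt (inner a a)"
definition dist_wl2 :: "wl2 \<Rightarrow> wl2 \<Rightarrow> real" where "dist_wl2 a b = norm (a - b)"
definition sgn_wl2 :: "wl2 \<Rightarrow> wl2" where "sgn_wl2 a = scaleR (inverse (norm a)) a"
definition uniformity_wl2 :: "(wl2 \<times> wl2) filter"
  where "uniformity_wl2 = (INF e\<in>{0<..}. principal {(x, y). dist x y < e})"
definition open_wl2 :: "wl2 set \<Rightarrow> bool"
  where "open_wl2 U = (\<forall>x\<in>U. \<forall>\<^sub>F (x', y) in uniformity. x' = x \<longrightarrow> y \<in> U)"

instance
proof
  fix a b c :: wl2 and r s :: real
  show "a + b + c = a + (b + c)" "a + b = b + a" "0 + a = a" "- a + a = 0" "a - b = a + - b"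
    "r *\<^sub>R (a + b) = r *\<^sub>R a + r *\<^sub>R b" "(r + s) *\<^sub>R a = r *\<^sub>R a + s *\<^sub>R a"
    "r *\<^sub>R s *\<^sub>R a = (r * s) *\<^sub>R a" "1 *\<^sub>R a = a"
    by (simp_all add: coord_inject[symmetric] fun_eq_iff plus_wl2.rep_eq zero_wl2.rep_eq
        uminus_wl2.rep_eq minus_wl2.rep_eq scaleR_wl2.rep_eq algebra_simps)
  show "inner a b = inner b a"
    by (simp add: inner_wl2.rep_eq mult.commute[of "coord a _"])
  show "inner (a + b) c = inner a c + inner b c"
    using suminf_add[OF summable_inner_wl2[of a c] summable_inner_wl2[of b c]]
    by (simp add: inner_wl2.rep_eq plus_wl2.rep_eq distrib_left distrib_right)
  show "inner (r *\<^sub>R a) b = r * inner a b"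
    using suminf_mult[OF summable_inner_wl2[of a b], of r]
    by (simp add: inner_wl2.rep_eq scaleR_wl2.rep_eq mult_ac)
  show "0 \<le> inner a a"
    unfolding inner_wl2.rep_eq by (rule suminf_nonneg[OF summable_inner_wl2]) simp
  show "inner a a = 0 \<longleftrightarrow> a = 0"
    using suminf_eq_zero_iff[OF summable_inner_wl2[of a a]]
    by (simp add: inner_wl2.rep_eq coord_inject[symmetric] zero_wl2.rep_eq fun_eq_iff)
  show "sgn a = inverse (norm a) *\<^sub>R a" by (rule sgn_wl2_def)
  show "dist a b = norm (a - b)" by (rule dist_wl2_def)
  show "norm a = sqrt (inner a a)" by (rule norm_wl2_def)
  show "(uniformity :: (wl2 \<times> wl2) filter) = (INF e\<in>{0<..}. principal {(x, y). dist x y < e})"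
    by (rule uniformity_wl2_def)
  show "open U = (\<forall>x\<in>U. \<forall>\<^sub>F (x', y) in uniformity. x' = x \<longrightarrow> y \<in> U)" for U :: "wl2 set"
    by (rule open_wl2_def)
qed

end

lemma norm_wl2_le:
  assumes "\<And>k. \<bar>coord a k\<bar> \<le> C"
  shows "norm a \<le> 2 * C"
proof -
  have C: "0 \<le> C" using assms[of 0] by linarith
  have "inner a a \<le> (\<Sum>k. (1/2) ^ k * (C * C))"
    unfolding inner_wl2.rep_eq
  proof (rule suminf_le)
    show "(1/2) ^ k * (coord a k * coord a k) \<le> (1/2) ^ k * (C * C)" for k
      using abs_le_square_iff[of "coord a k" C] assms[of k] C
      by (simp add: power2_eq_square)
    show "summable (\<lambda>k. (1/2) ^ k * (coord a k * coord a k))"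
      by (rule summable_inner_wl2)
    show "summable (\<lambda>k. (1/2) ^ k * (C * C))"
      by (intro summable_mult2 summable_geometric) simp
  qed
  also have "\<dots> = 2 * (C * C)"
    by (subst suminf_mult2[symmetric]) (auto simp: suminf_geometric intro!: summable_geometric)
  \<comment> \<open>The weights sum to 2, so the sharp constant is sqrt 2; rounding it up to 2 keeps
    the bound rational.\<close>
  also have "\<dots> \<le> (2 * C)\<^sup>2"
    by (simp add: power2_eq_square)
  finally show ?thesis
    unfolding norm_wl2_def using C by (simp add: real_le_lsqrt)
qed

text \<open>Dominated convergence for series: the weights turn the uniform bound on the coordinates
  into a summable majorant of the squared differences. Through this lemma \<open>rays\<close> maps
  bounded sequences to precompact ones.\<close>

lemma tendsto_wl2I:
  fixes f :: "'n \<Rightarrow> wl2"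
  assumes bound: "\<And>n k. \<bar>coord (f n) k\<bar> \<le> C"
    and lim: "\<And>k. ((\<lambda>n. coord (f n) k) \<longlongrightarrow> coord l k) F"
  shows "(f \<longlongrightarrow> l) F"
proof (cases "F = bot")
  case False
  obtain L where L: "\<And>k. \<bar>coord l k\<bar> \<le> L"
    using coord[of l] unfolding bounded_iff by auto
  have b: "\<bar>coord (f n - l) k\<bar> \<le> C + L" for n k
    using bound[of n k] L[of k] by (simp add: minus_wl2.rep_eq)
  have "((\<lambda>n. \<Sum>k. (1/2) ^ k * (coord (f n - l) k * coord (f n - l) k)) \<longlongrightarrow> (\<Sum>k. 0)) F"
  proof (rule tannerys_theorem[THEN conjunct2, THEN conjunct2])
    show "((\<lambda>n. (1/2) ^ k * (coord (f n - l) k * coord (f n - l) k)) \<longlongrightarrow> 0) F" for k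
    proof -
      have "((\<lambda>n. coord (f n) k - coord l k) \<longlongrightarrow> 0) F"
        using lim[of k] by (simp add: LIM_zero)
      then show ?thesis
        unfolding minus_wl2.rep_eq by (intro tendsto_mult_right_zero tendsto_mult_zero)
    qed
    show "summable (\<lambda>k. (1/2) ^ k * ((C + L) * (C + L)) :: real)"
      by (intro summable_mult2 summable_geometric) simp
    have "norm ((1/2) ^ k * (coord (f n - l) k * coord (f n - l) k)) \<le> (1/2) ^ k * ((C + L) * (C + L))"
      for n k
      unfolding norm_mult using b[of n k] by (intro mult_mono) auto
    then show "\<forall>\<^sub>F (k, n) in at_top \<times>\<^sub>F F. norm ((1/2) ^ k * (coord (f n - l) k * coord (f n - l) k))
        \<le> (1/2) ^ k * ((C + L) * (C + L))"
      by (intro always_eventually) auto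
  qed (fact False)
  then have "((\<lambda>n. sqrt (inner (f n - l) (f n - l))) \<longlongrightarrow> sqrt 0) F"
    unfolding inner_wl2.rep_eq by (intro tendsto_real_sqrt) simp
  then show ?thesis
    by (simp add: norm_wl2_def[symmetric] tendsto_iff dist_norm)
qed simp

text \<open>Strict convexity: equality in the triangle inequality for x and -y makes nonzero x and y
  point in opposite directions, and three directions cannot be pairwise opposite.\<close>

lemma three_opposite_vectors:
  fixes a b c :: "'a :: real_inner"
  assumes "norm (a - b) = norm a + norm b" "norm (a - c) = norm a + norm c"
    "norm (b - c) = norm b + norm c"
  shows "a = 0 \<or> b = 0 \<or> c = 0"
proof (rule ccontr)
  assume nz: "\<not> (a = 0 \<or> b = 0 \<or> c = 0)"
  have opp: "norm y *\<^sub>R x = - (norm x *\<^sub>R y)" if "norm (x - y) = norm x + norm y" for x y :: 'a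
    using norm_triangle_eq[of x "- y"] that by simp
  \<comment> \<open>Going from \<open>a\<close> to \<open>b\<close> to \<open>c\<close> and back to
    \<open>a\<close> changes the sign three times, so the vector equals its own negative.\<close>
  have "(norm b * norm c) *\<^sub>R a = norm c *\<^sub>R norm b *\<^sub>R a" by simp
  also have "\<dots> = - (norm a *\<^sub>R norm c *\<^sub>R b)"
    by (simp add: opp[OF assms(1)])
  also have "\<dots> = norm b *\<^sub>R norm a *\<^sub>R c"
    by (simp add: opp[OF assms(3)])
  also have "\<dots> = - ((norm b * norm c) *\<^sub>R a)"
    using opp[OF assms(2)] by (simp flip: scaleR_scaleR add: minus_equation_iff)
  finally have "(norm b * norm c) *\<^sub>R a = - ((norm b * norm c) *\<^sub>R a)" .
  then have "(norm b * norm c) *\<^sub>R a = 0"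
    by (simp add: eq_neg_iff_add_eq_0 flip: scaleR_2)
  with nz show False by simp
qed

text \<open>
  Tychonoff's theorem; a finer filter takes the place of a diagonal subsequence and copes with
  uncountable index types.
\<close>

lemma converges_along_finer_filter:
  fixes v :: "'n \<Rightarrow> 'i \<Rightarrow> real"
  assumes bound: "\<And>n i. \<bar>v n i\<bar> \<le> B i" and "F \<noteq> bot"
  obtains G l where "G \<le> F" "G \<noteq> bot" "\<And>i. ((\<lambda>n. v n i) \<longlongrightarrow> l i) G"
proof -
  let ?K = "PiE UNIV (\<lambda>i. {- B i..B i})"
  have "compactin (product_topology (\<lambda>_. euclideanreal) UNIV) ?K"
    by (simp add: compactin_PiE)
  then have "compact ?K"
    by (simp add: euclidean_product_topology)
  moreover have "\<forall>\<^sub>F x in filtermap v F. x \<in> ?K"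
    using bound by (simp add: eventually_filtermap PiE_iff abs_le_iff minus_le_iff)
  ultimately obtain l where l: "inf (nhds l) (filtermap v F) \<noteq> bot"
    using \<open>F \<noteq> bot\<close> compact_filter[of ?K] filtermap_bot_iff[of v F] by blast
  \<comment> \<open>By compactness \<open>l\<close> is a cluster point of \<open>v\<close> along
    \<open>F\<close>; \<open>G\<close> is the coarsest refinement of \<open>F\<close> along which
    \<open>v\<close> tends to \<open>l\<close>, and it is proper because \<open>l\<close> is a
    cluster point.\<close>
  define G where "G = inf F (filtercomap v (nhds l))"
  have "G \<noteq> bot"
  proof
    assume "G = bot"
    then obtain P Q where "eventually P F" "eventually Q (nhds l)" and PQ: "\<And>n. P n \<Longrightarrow> \<not> Q (v n)"
      unfolding G_def trivial_limit_def eventually_inf eventually_filtercomap by metis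
    then have "eventually (\<lambda>x. \<not> Q x) (filtermap v F)"
      by (auto simp: eventually_filtermap elim: eventually_mono)
    then have "eventually (\<lambda>_. False) (inf (nhds l) (filtermap v F))"
      using \<open>eventually Q (nhds l)\<close> unfolding eventually_inf by blast
    with l show False by (simp add: trivial_limit_def)
  qed
  moreover have "(v \<longlongrightarrow> l) G"
    by (simp add: G_def filterlim_iff_le_filtercomap)
  then have "((\<lambda>n. v n i) \<longlongrightarrow> l i) G" for i
    by (rule continuous_on_tendsto_compose[OF continuous_on_product_coordinates]) auto
  moreover have "G \<le> F" by (simp add: G_def)
  ultimately show thesis using that by blast
qed

section \<open>Absolutely summable families\<close>

text \<open>On the reals, \<open>summable_on\<close> is absolute summability.\<close>

definition l1norm :: "('i \<Rightarrow> real) \<Rightarrow> real" where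
  "l1norm x = (\<Sum>\<^sub>\<infinity>s. \<bar>x s\<bar>)"

lemma abs_summable_real:
  fixes x :: "'i \<Rightarrow> real"
  assumes "x summable_on UNIV"
  shows "(\<lambda>s. \<bar>x s\<bar>) summable_on A"
  using assms summable_on_iff_abs_summable_on_real[of x UNIV] summable_on_subset[OF _ subset_UNIV]
  by auto

lemma summable_on_diff_real:
  fixes x y :: "'i \<Rightarrow> real"
  assumes "x summable_on A" "y summable_on A"
  shows "(\<lambda>s. x s - y s) summable_on A"
  using summable_on_add[OF assms(1), of "\<lambda>s. - y s"] assms(2) by (simp add: summable_on_uminus)

lemma l1norm_nonneg: "0 \<le> l1norm x"
  unfolding l1norm_def by (rule infsum_nonneg) simp

lemma sum_le_l1norm:
  assumes "x summable_on UNIV" "finite F"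
  shows "(\<Sum>s\<in>F. \<bar>x s\<bar>) \<le> l1norm x"
  unfolding l1norm_def using assms abs_summable_real by (intro finite_sum_le_infsum) auto

lemma abs_le_l1norm: "x summable_on UNIV \<Longrightarrow> \<bar>x s\<bar> \<le> l1norm x"
  using sum_le_l1norm[of x "{s}"] by simp

text \<open>Bounds on finite partial sums survive pointwise limits, so this criterion is what places
  pointwise limits in l1, with a norm bound.\<close>

lemma l1norm_boundI:
  assumes "\<And>F. finite F \<Longrightarrow> (\<Sum>s\<in>F. \<bar>x s\<bar>) \<le> C"
  shows "x summable_on UNIV" "l1norm x \<le> C"
proof -
  have s: "(\<lambda>s. \<bar>x s\<bar>) summable_on UNIV"
  proof (rule nonneg_bdd_above_summable_on)
    show "bdd_above (sum (\<lambda>s. \<bar>x s\<bar>) ` {F. F \<subseteq> UNIV \<and> finite F})"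
      by (rule bdd_aboveI2[where M = C]) (simp add: assms)
  qed simp
  then show "x summable_on UNIV"
    using summable_on_iff_abs_summable_on_real[of x UNIV] by simp
  show "l1norm x \<le> C"
    unfolding l1norm_def by (rule infsum_le_finite_sums[OF s]) (simp add: assms)
qed

lemma l1norm_add_le:
  assumes "x summable_on UNIV" "y summable_on UNIV"
  shows "l1norm (\<lambda>s. x s + y s) \<le> l1norm x + l1norm y"
  unfolding l1norm_def
  by (subst infsum_add[symmetric])
    (auto intro!: abs_summable_real infsum_mono summable_on_add assms)

lemma l1norm_cmult: "l1norm (\<lambda>s. c * x s) = \<bar>c\<bar> * l1norm x"
  by (simp add: l1norm_def abs_mult infsum_cmult_right')

lemma l1norm_eq_0_iff:
  assumes "x summable_on UNIV"
  shows "l1norm x = 0 \<longleftrightarrow> x = (\<lambda>_. 0)"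
  using abs_le_l1norm[OF assms] by (auto simp: l1norm_def)

lemma l1norm_split:
  assumes "x summable_on UNIV" "finite F"
  shows "l1norm x = (\<Sum>s\<in>F. \<bar>x s\<bar>) + (\<Sum>\<^sub>\<infinity>s\<in>-F. \<bar>x s\<bar>)"
  using infsum_Un_disjoint[of "\<lambda>s. \<bar>x s\<bar>" F "-F"] abs_summable_real[OF assms(1)] assms(2)
  by (simp add: l1norm_def)

lemma l1norm_small_tail:
  fixes x :: "'i \<Rightarrow> real"
  assumes "x summable_on UNIV" "0 < e"
  obtains F where "finite F" "(\<Sum>\<^sub>\<infinity>s\<in>-F. \<bar>x s\<bar>) \<le> e"
proof -
  obtain F where "finite F" "dist (\<Sum>s\<in>F. \<bar>x s\<bar>) (l1norm x) \<le> e"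
    using infsum_finite_approximation[OF abs_summable_real[OF assms(1), of UNIV] assms(2)]
    unfolding l1norm_def by blast
  with that[of F] l1norm_split[OF assms(1)] show thesis
    by (simp add: dist_real_def)
qed

text \<open>The triangle inequality is used in opposite directions: \<open>y\<close> is the error
  term on \<open>F\<close>, and \<open>x\<close> is the error term off \<open>F\<close>. The loss is
  small when \<open>F\<close> carries most of \<open>x\<close> and little of
  \<open>y\<close>.\<close>

lemma l1norm_diff_ge:
  assumes "x summable_on UNIV" "y summable_on UNIV" "finite F"
  shows "l1norm x + l1norm y - 2 * (\<Sum>s\<in>F. \<bar>y s\<bar>) - 2 * (\<Sum>\<^sub>\<infinity>s\<in>-F. \<bar>x s\<bar>)
    \<le> l1norm (\<lambda>s. x s - y s)"
proof -
  have d: "(\<lambda>s. x s - y s) summable_on UNIV"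
    using assms by (intro summable_on_diff_real)
  have "(\<Sum>s\<in>F. \<bar>x s\<bar>) \<le> (\<Sum>s\<in>F. \<bar>x s - y s\<bar> + \<bar>y s\<bar>)"
    by (intro sum_mono) auto
  moreover have "(\<Sum>\<^sub>\<infinity>s\<in>-F. \<bar>y s\<bar>) \<le> (\<Sum>\<^sub>\<infinity>s\<in>-F. \<bar>x s - y s\<bar> + \<bar>x s\<bar>)"
    using assms d by (intro infsum_mono summable_on_add abs_summable_real) auto
  moreover have "\<dots> = (\<Sum>\<^sub>\<infinity>s\<in>-F. \<bar>x s - y s\<bar>) + (\<Sum>\<^sub>\<infinity>s\<in>-F. \<bar>x s\<bar>)"
    using assms d by (intro infsum_add abs_summable_real)
  ultimately show ?thesis
    using assms d by (simp add: l1norm_split sum.distrib)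
qed

lemma almost_disjoint_l1:
  assumes x: "x summable_on UNIV" and y: "\<And>n. y n summable_on UNIV"
    and null: "\<And>s. ((\<lambda>n. y n s) \<longlongrightarrow> 0) F" and e: "0 < e"
  shows "\<forall>\<^sub>F n in F. l1norm x + l1norm (y n) - e \<le> l1norm (\<lambda>s. x s - y n s)"
proof -
  \<comment> \<open>Two errors of at most \<open>e / 4\<close>, each counted twice, add up to at
    most \<open>e\<close>.\<close>
  obtain A where A: "finite A" "(\<Sum>\<^sub>\<infinity>s\<in>-A. \<bar>x s\<bar>) \<le> e / 4"
    using l1norm_small_tail[OF x, of "e / 4"] e by auto
  have "((\<lambda>n. \<Sum>s\<in>A. \<bar>y n s\<bar>) \<longlongrightarrow> (\<Sum>s\<in>A. \<bar>0\<bar>)) F"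
    by (intro tendsto_sum tendsto_rabs null)
  then have "\<forall>\<^sub>F n in F. (\<Sum>s\<in>A. \<bar>y n s\<bar>) < e / 4"
    using e by (intro order_tendstoD(2)[where y = 0]) auto
  then show ?thesis
  proof eventually_elim
    case (elim n)
    with l1norm_diff_ge[OF x y[of n] A(1)] A(2) show ?case by linarith
  qed
qed

text \<open>
  The sums of \<open>x\<close> over the rays \<open>(q, \<infinity>)\<close> with \<open>q\<close> rational, \<open>from_nat\<close> enumerating the rationals.
  Countably many functionals separate the points although the index set is uncountable.
\<close>

definition rays :: "(real \<Rightarrow> real) \<Rightarrow> wl2" where
  "rays x = Abs_wl2 (\<lambda>k. \<Sum>\<^sub>\<infinity>s\<in>{real_of_rat (from_nat k)<..}. x s)"

lemma abs_infsum_le_l1norm: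
  fixes x :: "'i \<Rightarrow> real"
  assumes "x summable_on UNIV"
  shows "\<bar>infsum x A\<bar> \<le> (\<Sum>\<^sub>\<infinity>s\<in>A. \<bar>x s\<bar>)" "(\<Sum>\<^sub>\<infinity>s\<in>A. \<bar>x s\<bar>) \<le> l1norm x"
proof -
  show "\<bar>infsum x A\<bar> \<le> (\<Sum>\<^sub>\<infinity>s\<in>A. \<bar>x s\<bar>)"
    using norm_infsum_bound[of x A] abs_summable_real[OF assms] by simp
  show "(\<Sum>\<^sub>\<infinity>s\<in>A. \<bar>x s\<bar>) \<le> l1norm x"
    unfolding l1norm_def using abs_summable_real[OF assms] by (intro infsum_mono2) auto
qed

lemma coord_rays:
  assumes "x summable_on UNIV"
  shows "coord (rays x) k = (\<Sum>\<^sub>\<infinity>s\<in>{real_of_rat (from_nat k)<..}. x s)"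
proof -
  have "bounded (range (\<lambda>k. \<Sum>\<^sub>\<infinity>s\<in>{real_of_rat (from_nat k)<..}. x s))"
    using abs_infsum_le_l1norm[OF assms] by (intro boundedI[where B = "l1norm x"]) (auto intro: order_trans)
  then show ?thesis
    unfolding rays_def by (subst Abs_wl2_inverse) auto
qed

lemma abs_coord_rays_le: "x summable_on UNIV \<Longrightarrow> \<bar>coord (rays x) k\<bar> \<le> l1norm x"
  using abs_infsum_le_l1norm[of x] by (auto simp: coord_rays intro: order_trans)

lemma norm_rays_le: "x summable_on UNIV \<Longrightarrow> norm (rays x) \<le> 2 * l1norm x"
  by (intro norm_wl2_le abs_coord_rays_le)

lemma rays_add:
  assumes "x summable_on UNIV" "y summable_on UNIV"
  shows "rays (\<lambda>s. x s + y s) = rays x + rays y"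
  using assms summable_on_subset[OF _ subset_UNIV]
  by (auto simp: coord_inject[symmetric] fun_eq_iff plus_wl2.rep_eq coord_rays summable_on_add
      intro!: infsum_add)

lemma rays_cmult:
  assumes "x summable_on UNIV"
  shows "rays (\<lambda>s. c * x s) = c *\<^sub>R rays x"
  using assms
  by (simp add: coord_inject[symmetric] fun_eq_iff scaleR_wl2.rep_eq coord_rays
      summable_on_cmult_right infsum_cmult_right')

lemma rays_diff:
  assumes "x summable_on UNIV" "y summable_on UNIV"
  shows "rays (\<lambda>s. x s - y s) = rays x - rays y"
  using rays_add[OF assms(1) summable_on_cmult_right[OF assms(2), of "-1"]] rays_cmult[OF assms(2), of "-1"]
  by simp

text \<open>Differences of rays show that \<open>x\<close> sums to 0 over every interval (p, q] with
  rational ends. If \<open>x s\<close> were nonzero, a short interval around \<open>s\<close> would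
  miss all other points of a finite set carrying most of the mass, and the rest is too small to
  cancel \<open>x s\<close>.\<close>

lemma rays_eq_0D:
  assumes x: "x summable_on UNIV" and 0: "rays x = 0"
  shows "x = (\<lambda>_. 0)"
proof (rule ccontr)
  assume "x \<noteq> (\<lambda>_. 0)"
  then obtain s where s: "x s \<noteq> 0" by auto
  have on: "x summable_on A" for A
    using summable_on_subset[OF x subset_UNIV] .
  obtain F where F: "finite F" "(\<Sum>\<^sub>\<infinity>t\<in>-F. \<bar>x t\<bar>) \<le> \<bar>x s\<bar> / 2"
    using l1norm_small_tail[OF x, of "\<bar>x s\<bar> / 2"] s by auto
  obtain d where d: "0 < d" "\<And>t. t \<in> F \<Longrightarrow> t \<noteq> s \<Longrightarrow> d \<le> dist s t"
    using finite_set_avoid[OF F(1), of s] by auto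
  obtain p q where p: "s - d < real_of_rat p" "real_of_rat p < s"
    and q: "s < real_of_rat q" "real_of_rat q < s + d"
    using of_rat_dense[of "s - d" s] of_rat_dense[of s "s + d"] d(1) by auto
  \<comment> \<open>The index \<open>to_nat r\<close> is decoded by \<open>from_nat\<close> to the
    rational \<open>r\<close>.\<close>
  have ray: "infsum x {real_of_rat r<..} = 0" for r
    using coord_rays[OF x, of "to_nat r"] 0 by (simp add: zero_wl2.rep_eq)
  define A where "A = {real_of_rat p<..real_of_rat q} - {s}"
  have "{real_of_rat p<..} = (A \<union> {s}) \<union> {real_of_rat q<..}"
    using p q by (auto simp: A_def)
  moreover have "infsum x ((A \<union> {s}) \<union> {real_of_rat q<..})
      = infsum x (A \<union> {s}) + infsum x {real_of_rat q<..}"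
    using on q by (intro infsum_Un_disjoint) (auto simp: A_def)
  moreover have "infsum x (A \<union> {s}) = infsum x A + infsum x {s}"
    using on by (intro infsum_Un_disjoint) (auto simp: A_def)
  ultimately have "x s = - infsum x A"
    using ray[of p] ray[of q] by simp
  moreover have "A \<subseteq> - F"
    using d(2) p q by (fastforce simp: A_def dist_real_def)
  then have "(\<Sum>\<^sub>\<infinity>t\<in>A. \<bar>x t\<bar>) \<le> (\<Sum>\<^sub>\<infinity>t\<in>-F. \<bar>x t\<bar>)"
    by (intro infsum_mono2 abs_summable_real x) auto
  ultimately show False
    using abs_infsum_le_l1norm(1)[OF x, of A] F(2) s by auto
qed

lemma inj_on_rays: "inj_on rays {x. x summable_on UNIV}"
proof (rule inj_onI)
  fix x y assume "x \<in> {x. x summable_on UNIV}" "y \<in> {x. x summable_on UNIV}" "rays x = rays y"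
  then have "(\<lambda>s. x s - y s) = (\<lambda>_. 0)"
    by (intro rays_eq_0D) (auto simp: rays_diff intro: summable_on_diff_real)
  then show "x = y" by (simp add: fun_eq_iff)
qed

section \<open>The renormed space\<close>

text \<open>This is l1(R); the uncountable index set supplies continuum many unit vectors.\<close>

definition l1_module :: "(real, real \<Rightarrow> real) module" where
  "l1_module = \<lparr>carrier = {x. x summable_on UNIV}, monoid.mult = (\<lambda>x y. x), one = (\<lambda>_. 0),
     zero = (\<lambda>_. 0), add = (\<lambda>x y s. x s + y s), module.smult = (\<lambda>c x s. c * x s)\<rparr>"

text \<open>Here \<open>rays\<close> is the operator T, and its target \<open>wl2\<close> supplies
  the strictly convex part of the norm.\<close>

definition renorm :: "(real \<Rightarrow> real) \<Rightarrow> real" where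
  "renorm x = l1norm x + norm (rays x)"

lemma l1_module_simps [simp]:
  "carrier l1_module = {x. x summable_on UNIV}"
  "\<zero>\<^bsub>l1_module\<^esub> = (\<lambda>_. 0)"
  "x \<oplus>\<^bsub>l1_module\<^esub> y = (\<lambda>s. x s + y s)"
  "c \<odot>\<^bsub>l1_module\<^esub> x = (\<lambda>s. c * x s)"
  by (simp_all add: l1_module_def)

lemma l1norm_le_renorm: "l1norm x \<le> renorm x"
  by (simp add: renorm_def)

text \<open>Together with \<open>l1norm_le_renorm\<close> this makes the two norms equivalent, so
  completeness can be checked in l1.\<close>

lemma renorm_le: "x summable_on UNIV \<Longrightarrow> renorm x \<le> 3 * l1norm x"
  using norm_rays_le[of x] by (simp add: renorm_def)

lemma abelian_group_l1_module: "abelian_group l1_module"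
proof (rule abelian_groupI)
  show "\<exists>y\<in>carrier l1_module. y \<oplus>\<^bsub>l1_module\<^esub> x = \<zero>\<^bsub>l1_module\<^esub>" if "x \<in> carrier l1_module" for x
    using that by (intro bexI[of _ "\<lambda>s. - x s"]) (auto simp: summable_on_uminus)
qed (auto simp: summable_on_add add_ac)

lemma cring_real_scalars: "cring real_scalars"
proof (rule cringI)
  show "abelian_group real_scalars"
  proof (rule abelian_groupI)
    show "\<exists>y\<in>carrier real_scalars. y \<oplus>\<^bsub>real_scalars\<^esub> x = \<zero>\<^bsub>real_scalars\<^esub>" for x
      by (intro bexI[of _ "- x"]) (auto simp: real_scalars_def)
  qed (auto simp: real_scalars_def)
  show "Group.comm_monoid real_scalars"
    by (rule comm_monoidI) (auto simp: real_scalars_def)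
qed (auto simp: real_scalars_def algebra_simps)

interpretation l1: real_normed_space l1_module renorm
proof (intro real_normed_space.intro real_normed_space_axioms.intro)
  show "Module.module real_scalars l1_module"
    by (intro Module.moduleI cring_real_scalars abelian_group_l1_module)
      (auto simp: real_scalars_def summable_on_cmult_right algebra_simps)
  fix x y :: "real \<Rightarrow> real" and a :: real
  assume x: "x \<in> carrier l1_module"
  have "rays (\<lambda>_. 0) = 0"
    using rays_cmult[of "\<lambda>_. 0" 0] by simp
  then show "renorm x = 0 \<longleftrightarrow> x = \<zero>\<^bsub>l1_module\<^esub>"
    using x l1norm_le_renorm[of x] l1norm_nonneg[of x] l1norm_eq_0_iff[of x]
    by (auto simp: renorm_def add_nonneg_eq_0_iff)
  show "renorm (a \<odot>\<^bsub>l1_module\<^esub> x) = \<bar>a\<bar> * renorm x"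
    using x by (simp add: renorm_def l1norm_cmult rays_cmult distrib_left)
  assume "y \<in> carrier l1_module"
  with x show "renorm (x \<oplus>\<^bsub>l1_module\<^esub> y) \<le> renorm x + renorm y"
    using l1norm_add_le[of x y] norm_triangle_ineq[of "rays x" "rays y"]
    by (simp add: renorm_def rays_add)
qed

lemma l1_module_minus [simp]:
  assumes "x summable_on UNIV" "y summable_on UNIV"
  shows "x \<ominus>\<^bsub>l1_module\<^esub> y = (\<lambda>s. x s - y s)"
proof -
  have "\<ominus>\<^bsub>l1_module\<^esub> y = (\<lambda>s. - y s)"
    using assms by (intro l1.M.minus_equality) (auto simp: summable_on_uminus)
  then show ?thesis
    by (simp add: a_minus_def)
qed

lemma norm_dist_l1 [simp]:
  assumes "x summable_on UNIV" "y summable_on UNIV"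
  shows "norm_dist l1_module renorm x y = renorm (\<lambda>s. x s - y s)"
  using assms by (simp add: norm_dist_def)

section \<open>Completeness of the renormed space\<close>

lemma l1_complete: "l1.mcomplete"
  unfolding l1.mcomplete_def
proof (intro allI impI)
  fix \<sigma> assume "l1.MCauchy \<sigma>"
  then have \<sigma>: "\<sigma> n summable_on UNIV" for n
    unfolding l1.MCauchy_def by auto
  have C: "\<exists>M. \<forall>m\<ge>M. \<forall>n\<ge>M. renorm (\<lambda>s. \<sigma> m s - \<sigma> n s) < e" if "0 < e" for e
    using \<open>l1.MCauchy \<sigma>\<close> that \<sigma> unfolding l1.MCauchy_def by simp
  \<comment> \<open>Each coordinate is dominated by \<open>renorm\<close>, which yields a pointwise
    limit \<open>x\<close>.\<close>
  have "Cauchy (\<lambda>n. \<sigma> n s)" for s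
  proof (rule CauchyI)
    fix e :: real assume "0 < e"
    then obtain M where "\<forall>m\<ge>M. \<forall>n\<ge>M. renorm (\<lambda>s. \<sigma> m s - \<sigma> n s) < e" using C by blast
    moreover have "norm (\<sigma> m s - \<sigma> n s) \<le> renorm (\<lambda>s. \<sigma> m s - \<sigma> n s)" for m n
      using abs_le_l1norm[OF summable_on_diff_real[OF \<sigma>[of m] \<sigma>[of n]], of s] l1norm_le_renorm
      by (fastforce intro: order_trans)
    ultimately show "\<exists>M. \<forall>m\<ge>M. \<forall>n\<ge>M. norm (\<sigma> m s - \<sigma> n s) < e"
      by (meson le_less_trans)
  qed
  then obtain x where x: "\<And>s. (\<lambda>n. \<sigma> n s) \<longlonglongrightarrow> x s"
    unfolding convergent_eq_Cauchy[symmetric] convergent_def by metis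
  \<comment> \<open>The Cauchy bound holds for all finite partial sums and is kept as the first
    index tends to infinity. Summability of \<open>x\<close> itself follows by adding back one
    \<sigma> n.\<close>
  have close: "\<exists>M. \<forall>n\<ge>M. (\<lambda>s. x s - \<sigma> n s) summable_on UNIV \<and> l1norm (\<lambda>s. x s - \<sigma> n s) \<le> e"
    if "0 < e" for e
  proof -
    obtain M where M: "\<And>m n. M \<le> m \<Longrightarrow> M \<le> n \<Longrightarrow> renorm (\<lambda>s. \<sigma> m s - \<sigma> n s) < e"
      using C[OF \<open>0 < e\<close>] by blast
    have "(\<Sum>s\<in>F. \<bar>x s - \<sigma> n s\<bar>) \<le> e" if "finite F" "M \<le> n" for F n
    proof (rule tendsto_upperbound)
      show "(\<lambda>m. \<Sum>s\<in>F. \<bar>\<sigma> m s - \<sigma> n s\<bar>) \<longlonglongrightarrow> (\<Sum>s\<in>F. \<bar>x s - \<sigma> n s\<bar>)"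
        by (intro tendsto_intros x)
      have "(\<Sum>s\<in>F. \<bar>\<sigma> m s - \<sigma> n s\<bar>) \<le> e" if "M \<le> m" for m
        using sum_le_l1norm[OF summable_on_diff_real[OF \<sigma>[of m] \<sigma>[of n]] \<open>finite F\<close>]
          l1norm_le_renorm[of "\<lambda>s. \<sigma> m s - \<sigma> n s"] M[OF that \<open>M \<le> n\<close>] by linarith
      then show "\<forall>\<^sub>F m in sequentially. (\<Sum>s\<in>F. \<bar>\<sigma> m s - \<sigma> n s\<bar>) \<le> e"
        by (auto simp: eventually_sequentially)
    qed simp
    then show ?thesis
      by (intro exI[of _ M]) (auto intro: l1norm_boundI)
  qed
  have xs: "x summable_on UNIV"
  proof -
    obtain n where "(\<lambda>s. x s - \<sigma> n s) summable_on UNIV" using close[of 1] by auto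
    from summable_on_add[OF this \<sigma>[of n]] show ?thesis by simp
  qed
  have "\<exists>M. \<forall>n\<ge>M. renorm (\<lambda>s. \<sigma> n s - x s) < e" if "0 < e" for e
  proof -
    \<comment> \<open>The factor 3 of \<open>renorm_le\<close> turns \<open>e / 4\<close> into
      something strictly below \<open>e\<close>.\<close>
    obtain M where M: "\<And>n. M \<le> n \<Longrightarrow> l1norm (\<lambda>s. x s - \<sigma> n s) \<le> e / 4"
      using close[of "e / 4"] \<open>0 < e\<close> by auto
    have "renorm (\<lambda>s. \<sigma> n s - x s) < e" if "M \<le> n" for n
      using renorm_le[OF summable_on_diff_real[OF \<sigma> xs], of n] M[OF that] \<open>0 < e\<close>
        l1norm_cmult[of "-1" "\<lambda>s. x s - \<sigma> n s"] by simp
    then show ?thesis by blast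
  qed
  then show "\<exists>x. limitin l1.mtopology \<sigma> x sequentially"
    unfolding l1.limit_metric_sequentially using \<sigma> xs by (intro exI[of _ x]) simp
qed

section \<open>Density continuum: upper and lower bound\<close>

lemma nat_funs_lepoll_nat_sets: "(UNIV :: (nat \<Rightarrow> real) set) \<lesssim> (UNIV :: nat set set)"
proof -
  obtain f :: "real \<Rightarrow> nat set" where f: "inj f"
    using eqpoll_imp_lepoll[OF eqpoll_sym[OF nat_sets_eqpoll_reals]] unfolding lepoll_def by blast
  \<comment> \<open>Each real is coded by a set of naturals, and a sequence of such sets by one set
    of pairs.\<close>
  have "inj (\<lambda>a :: nat \<Rightarrow> real. to_nat ` {(k, j). j \<in> f (a k)})"
  proof (rule injI)
    fix a b :: "nat \<Rightarrow> real"
    assume "to_nat ` {(k, j). j \<in> f (a k)} = to_nat ` {(k, j). j \<in> f (b k)}"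
    then have "{(k, j). j \<in> f (a k)} = {(k, j). j \<in> f (b k)}"
      by (simp add: inj_image_eq_iff)
    then have "f (a k) = f (b k)" for k by auto
    with f show "a = b" by (auto simp: inj_eq)
  qed
  then show ?thesis unfolding lepoll_def by blast
qed

text \<open>The countably many ray sums determine \<open>x\<close>, so a point is coded by a real
  sequence. This bounds the size of the whole space, not only of some dense subset.\<close>

lemma l1_carrier_lepoll: "carrier l1_module \<lesssim> (UNIV :: nat set set)"
proof -
  have "inj_on (coord \<circ> rays) (carrier l1_module)"
    using inj_on_rays by (auto simp: inj_on_def coord_inject)
  then have "carrier l1_module \<lesssim> (UNIV :: (nat \<Rightarrow> real) set)"
    unfolding lepoll_def by blast
  with nat_funs_lepoll_nat_sets show ?thesis
    using lepoll_trans by blast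
qed

text \<open>Distinct unit vectors \<open>e t\<close> have l1 distance 2, and \<open>renorm\<close>
  dominates the l1 norm; hence points of \<open>D\<close> within distance less than 1 of different
  unit vectors are different.\<close>

lemma nat_sets_lepoll_dense_l1:
  assumes "dense_in (norm_topology l1_module renorm) D"
  shows "(UNIV :: nat set set) \<lesssim> D"
proof -
  define e :: "real \<Rightarrow> real \<Rightarrow> real" where "e = (\<lambda>t s. if s = t then 1 else 0)"
  have e: "e t summable_on UNIV" for t
    unfolding e_def by (rule finite_nonzero_values_imp_summable_on) simp
  have D: "D \<subseteq> carrier l1_module" "l1.mtopology closure_of D = carrier l1_module"
    using assms unfolding dense_in_def norm_topology_def by (simp_all del: l1_module_simps)
  have "e t \<in> l1.mtopology closure_of D" for t
    unfolding D(2) using e by simp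
  then have "\<exists>d\<in>D. norm_dist l1_module renorm (e t) d < 1" for t
    unfolding l1.metric_closure_of l1.in_mball using zero_less_one by blast
  with D(1) obtain d where d: "\<And>t. d t \<in> D" "\<And>t. d t summable_on UNIV" "\<And>t. renorm (\<lambda>s. e t s - d t s) < 1"
    using e by simp (metis norm_dist_l1 mem_Collect_eq subsetD)
  have "inj d"
  proof (rule injI, rule ccontr)
    fix t u assume tu: "d t = d u" "t \<noteq> u"
    have s: "(\<lambda>s. e v s - d v s) summable_on UNIV" for v
      by (intro summable_on_diff_real e d)
    have "l1norm (\<lambda>s. (e t s - d t s) + (-1) * (e u s - d u s))
        \<le> l1norm (\<lambda>s. e t s - d t s) + l1norm (\<lambda>s. e u s - d u s)"
      using l1norm_add_le[OF s[of t] summable_on_cmult_right[OF s[of u], of "-1"]]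
        l1norm_cmult[of "-1" "\<lambda>s. e u s - d u s"] by simp
    also have "\<dots> < 2"
      using d(3)[of t] d(3)[of u] l1norm_le_renorm[of "\<lambda>s. e t s - d t s"]
        l1norm_le_renorm[of "\<lambda>s. e u s - d u s"] by linarith
    also have "2 = (\<Sum>s\<in>{t, u}. \<bar>e t s - e u s\<bar>)"
      using tu(2) by (simp add: e_def)
    also have "\<dots> \<le> l1norm (\<lambda>s. e t s - e u s)"
      by (intro sum_le_l1norm summable_on_diff_real e) simp
    also have "(\<lambda>s. e t s - e u s) = (\<lambda>s. (e t s - d t s) + (-1) * (e u s - d u s))"
      using tu(1) by simp
    finally show False by simp
  qed
  then have "(UNIV :: real set) \<lesssim> D"
    unfolding lepoll_def using d(1) by blast
  with nat_sets_eqpoll_reals show ?thesis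
    using lepoll_trans1 by blast
qed

text \<open>The carrier itself serves as a dense set of least cardinality: it is bounded above by
  \<open>l1_carrier_lepoll\<close> and below, being dense, by
  \<open>nat_sets_lepoll_dense_l1\<close>.\<close>

lemma has_density_l1: "has_density (norm_topology l1_module renorm) (UNIV :: nat set set)"
proof -
  have "dense_in (norm_topology l1_module renorm) (carrier l1_module)"
    unfolding dense_in_def norm_topology_def
    using closure_of_topspace[of l1.mtopology] by (simp only: l1.topspace_mtopology subset_refl simp_thms)
  with l1_carrier_lepoll nat_sets_lepoll_dense_l1 show ?thesis
    unfolding has_density_def using lepoll_antisym by blast
qed

section \<open>Equilateral sets\<close>

lemma no_infinite_equilateral_l1:
  assumes "equilateral l1_module renorm r Y" "infinite Y"
  shows False
proof -
  obtain x :: "nat \<Rightarrow> real \<Rightarrow> real" where x: "inj x" "range x \<subseteq> Y"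
    using infinite_countable_subset[OF assms(2)] by blast
  have xs: "x n summable_on UNIV" for n
    using x(2) assms(1) unfolding equilateral_def by auto
  have dist: "l1norm (\<lambda>s. x n s - x m s) + norm (rays (x n) - rays (x m)) = r" if "n \<noteq> m" for n m
  proof -
    have "x n \<noteq> x m" "x n \<in> Y" "x m \<in> Y" using x that by (auto dest: injD)
    then have "renorm (x n \<ominus>\<^bsub>l1_module\<^esub> x m) = r"
      using assms(1) unfolding equilateral_def by blast
    then show ?thesis by (simp add: renorm_def xs rays_diff)
  qed
  have "0 < r" using assms(1) by (simp add: equilateral_def)
  \<comment> \<open>All \<open>x n\<close> lie within \<open>r\<close> of \<open>x 0\<close>, so
    \<open>B\<close> bounds the whole sequence.\<close>
  define B where "B = l1norm (x 0) + r"
  have B: "l1norm (x n) \<le> B" for n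
  proof (cases "n = 0")
    case False
    have "l1norm (x n) \<le> l1norm (x 0) + l1norm (\<lambda>s. x n s - x 0 s)"
      using l1norm_add_le[OF xs[of 0] summable_on_diff_real[OF xs[of n] xs[of 0]]] by simp
    moreover have "l1norm (\<lambda>s. x n s - x 0 s) \<le> r"
      using dist[OF False] norm_ge_zero[of "rays (x n) - rays (x 0)"] by linarith
    ultimately show ?thesis by (simp add: B_def)
  qed (use \<open>0 < r\<close> in \<open>simp add: B_def\<close>)
  \<comment> \<open>The sum type joins the coordinates of \<open>x n\<close> with those of
    \<open>rays (x n)\<close>, so that a single filter makes both converge.\<close>
  define v where "v n = case_sum (x n) (coord (rays (x n)))" for n
  have "\<bar>v n i\<bar> \<le> B" for n i
    using abs_le_l1norm[OF xs[of n]] abs_coord_rays_le[OF xs[of n]] B[of n]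
    by (auto simp: v_def split: sum.split intro: order_trans)
  from converges_along_finer_filter[of v "\<lambda>_. B", OF this sequentially_bot]
  obtain F l where F: "F \<le> sequentially" "F \<noteq> bot" and l: "\<And>i. ((\<lambda>n. v n i) \<longlongrightarrow> l i) F"
    by blast
  define \<xi> where "\<xi> s = l (Inl s)" for s
  \<comment> \<open>Ray sums are not continuous under pointwise convergence, so the limit of
    \<open>rays (x n)\<close> gets its own name and may differ from
    \<open>rays \<xi>\<close>.\<close>
  define w where "w = Abs_wl2 (\<lambda>k. l (Inr k))"
  have \<xi>: "((\<lambda>n. x n s) \<longlongrightarrow> \<xi> s) F" for s
    using l[of "Inl s"] by (simp add: v_def \<xi>_def)
  have rl: "((\<lambda>n. coord (rays (x n)) k) \<longlongrightarrow> l (Inr k)) F" for k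
    using l[of "Inr k"] by (simp add: v_def)
  have rb: "\<bar>coord (rays (x n)) k\<bar> \<le> B" for n k
    using abs_coord_rays_le[OF xs[of n]] B[of n] by (rule order_trans)
  have "\<bar>l (Inr k)\<bar> \<le> B" for k
    by (rule tendsto_upperbound[OF tendsto_rabs[OF rl]]) (use rb F in auto)
  then have "coord w k = l (Inr k)" for k
    unfolding w_def by (subst Abs_wl2_inverse) (auto intro!: boundedI)
  then have w: "((\<lambda>n. rays (x n)) \<longlongrightarrow> w) F"
    using rb rl by (intro tendsto_wl2I) auto
  \<comment> \<open>A Fatou argument on finite sums places \<xi> in l1.\<close>
  have "(\<Sum>s\<in>A. \<bar>\<xi> s\<bar>) \<le> B" if "finite A" for A
  proof (rule tendsto_upperbound)
    show "((\<lambda>n. \<Sum>s\<in>A. \<bar>x n s\<bar>) \<longlongrightarrow> (\<Sum>s\<in>A. \<bar>\<xi> s\<bar>)) F"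
      by (intro tendsto_intros \<xi>)
    show "\<forall>\<^sub>F n in F. (\<Sum>s\<in>A. \<bar>x n s\<bar>) \<le> B"
      using sum_le_l1norm[OF xs that] B by (intro always_eventually) (blast intro: order_trans)
  qed (fact F)
  then have \<xi>s: "\<xi> summable_on UNIV" and \<xi>B: "l1norm \<xi> \<le> B"
    using l1norm_boundI[of \<xi> B] by blast+
  define z where "z n = (\<lambda>s. x n s - \<xi> s)" for n
  have zs: "z n summable_on UNIV" for n
    unfolding z_def by (intro summable_on_diff_real xs \<xi>s)
  have "\<bar>l1norm (z n)\<bar> \<le> B + B" for n
    using l1norm_add_le[OF xs[of n] summable_on_cmult_right[OF \<xi>s, of "-1"]]
      l1norm_cmult[of "-1" \<xi>] B[of n] \<xi>B l1norm_nonneg[of "z n"] by (simp add: z_def)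
  \<comment> \<open>A second refinement, with the one-point index type, makes the real sequence of
    norms converge as well.\<close>
  from converges_along_finer_filter[of "\<lambda>n (i::unit). l1norm (z n)" "\<lambda>_. B + B", OF this F(2)]
  obtain G and a' :: "unit \<Rightarrow> real" where G: "G \<le> F" "G \<noteq> bot" and a': "\<And>i. ((\<lambda>n. l1norm (z n)) \<longlongrightarrow> a' i) G"
    by blast
  define a where "a = a' ()"
  have a: "((\<lambda>n. l1norm (z n)) \<longlongrightarrow> a) G"
    unfolding a_def by (rule a')
  have z0: "((\<lambda>n. z n s) \<longlongrightarrow> 0) G" for s
    using tendsto_mono[OF G(1) \<xi>[of s]] by (simp add: z_def LIM_zero)
  define u where "u n = rays (x n) - w" for n
  have u0: "(u \<longlongrightarrow> 0) G"
    using tendsto_mono[OF G(1) w] by (simp add: u_def[abs_def] LIM_zero)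
  \<comment> \<open>The shifts by \<xi> and \<open>w\<close> cancel in differences.\<close>
  have dist_zu: "l1norm (\<lambda>s. z n s - z m s) + norm (u n - u m) = r" if "n \<noteq> m" for n m
    using dist[OF that] by (simp add: z_def u_def)
  have triangle: "l1norm (\<lambda>s. z n s - z m s) \<le> l1norm (z n) + l1norm (z m)" for n m
    using l1norm_add_le[OF zs[of n] summable_on_cmult_right[OF zs[of m], of "-1"]]
      l1norm_cmult[of "-1" "z m"] by simp
  have later: "\<forall>\<^sub>F m in G. n \<noteq> m" for n
  proof -
    have "\<forall>\<^sub>F m in sequentially. n \<noteq> m"
      using eventually_gt_at_top[of n] by eventually_elim simp
    with G(1) F(1) show ?thesis by (meson filter_leD order_trans)
  qed
  \<comment> \<open>Fix \<open>n\<close> and let \<open>m\<close> run along \<open>G\<close>. The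
    triangle inequalities bound \<open>r\<close> from above; \<open>almost_disjoint_l1\<close>
    bounds it from below, as \<open>z m\<close> tends to 0 pointwise and \<open>u m\<close> in
    norm.\<close>
  have const: "l1norm (z n) + norm (u n) = r - a" for n
  proof (rule antisym)
    have "r \<le> l1norm (z n) + a + (norm (u n) + norm (0 :: wl2))"
    proof (rule tendsto_lowerbound)
      show "((\<lambda>m. l1norm (z n) + l1norm (z m) + (norm (u n) + norm (u m)))
          \<longlongrightarrow> l1norm (z n) + a + (norm (u n) + norm (0 :: wl2))) G"
        by (intro tendsto_intros a u0)
      show "\<forall>\<^sub>F m in G. r \<le> l1norm (z n) + l1norm (z m) + (norm (u n) + norm (u m))"
        using later[of n]
      proof eventually_elim
        case (elim m)
        show ?case
          using dist_zu[OF elim] triangle[of n m] norm_triangle_ineq4[of "u n" "u m"] by linarith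
      qed
    qed (fact G)
    then show "r - a \<le> l1norm (z n) + norm (u n)" by simp
    show "l1norm (z n) + norm (u n) \<le> r - a"
    proof (rule field_le_epsilon)
      fix e :: real assume "0 < e"
      have "l1norm (z n) + a - e + norm (u n - 0) \<le> r"
      proof (rule tendsto_upperbound)
        show "((\<lambda>m. l1norm (z n) + l1norm (z m) - e + norm (u n - u m))
            \<longlongrightarrow> l1norm (z n) + a - e + norm (u n - 0)) G"
          by (intro tendsto_intros a u0)
        show "\<forall>\<^sub>F m in G. l1norm (z n) + l1norm (z m) - e + norm (u n - u m) \<le> r"
          using later[of n] almost_disjoint_l1[OF zs[of n] zs z0 \<open>0 < e\<close>]
        proof eventually_elim
          case (elim m)
          with dist_zu[OF elim(1)] show ?case by linarith
        qed
      qed (fact G)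
      then show "l1norm (z n) + norm (u n) \<le> r - a + e" by simp
    qed
  qed
  \<comment> \<open>Now \<open>n\<close> runs along \<open>G\<close> too, so the constant
    \<open>r - a\<close> must equal the limit \<open>a\<close>.\<close>
  have "((\<lambda>n. l1norm (z n) + norm (u n)) \<longlongrightarrow> a + norm (0 :: wl2)) G"
    by (intro tendsto_intros a u0)
  then have "((\<lambda>n :: nat. r - a) \<longlongrightarrow> a) G"
    by (simp add: const)
  then have "r - a = a"
    using G(2) by (simp add: tendsto_const_iff)
  \<comment> \<open>Adding \<open>const\<close> for \<open>n\<close> and \<open>m\<close> gives
    total 2 (r - a) = r, so both triangle inequalities in \<open>dist_zu\<close> are
    equalities.\<close>
  then have "norm (u n - u m) = norm (u n) + norm (u m)" if "n \<noteq> m" for n m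
    using dist_zu[OF that] const[of n] const[of m] triangle[of n m] norm_triangle_ineq4[of "u n" "u m"]
    by linarith
  then have zero: "u i = 0 \<or> u j = 0 \<or> u k = 0" if "i \<noteq> j" "i \<noteq> k" "j \<noteq> k" for i j k
    using that by (intro three_opposite_vectors) auto
  \<comment> \<open>Each triple of indices contains a zero of \<open>u\<close>; two disjoint triples
    yield two different zeros.\<close>
  have "\<exists>i\<in>{0, 1, 2}. u i = 0" "\<exists>j\<in>{3, 4, 5}. u j = 0"
    using zero[of 0 1 2] zero[of 3 4 5] by auto
  then obtain i j where "u i = 0" "u j = 0" "i \<noteq> j"
    by force
  then have "rays (x i) = rays (x j)" by (simp add: u_def)
  then have "x i = x j"
    using inj_on_rays xs by (auto dest: inj_onD)
  with \<open>i \<noteq> j\<close> x(1) show False by (auto dest: injD)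
qed

(* A metric space of density continuum has exactly continuum many points (each point is the limit
   of a sequence from a dense set), so every such Banach space has an isometric copy whose carrier
   is a subset of real => real: fixing this type loses no generality. *)
theorem corollary2:
  "\<exists>(V :: (real, real \<Rightarrow> real) module) (N :: (real \<Rightarrow> real) \<Rightarrow> real).
     real_banach_space V N
     \<and> has_density (norm_topology V N) (UNIV :: nat set set)
     \<and> \<not> (\<exists>r Y. equilateral V N r Y \<and> infinite Y)"
proof (intro exI conjI)
  show "real_banach_space l1_module renorm"
    by (intro real_banach_space.intro real_banach_space_axioms.intro
        l1.real_normed_space_axioms l1_complete)
  show "has_density (norm_topology l1_module renorm) (UNIV :: nat set set)"
    by (rule has_density_l1)
  show "\<not> (\<exists>r Y. equilateral l1_module renorm r Y \<and> infinite Y)"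
    using no_infinite_equilateral_l1 by blast
qed

end
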